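(* Let $f:\mathcal{D}\rightarrow\mathbb{R}$ be a subdifferentially regular function defined on an open domain $\mathcal{D}\subseteq\mathbb{R}^d$, and let $(\mathcal{L}_{\mathrm{lft}}, \mathcal{F}_{\mathrm{cvx}},\mathcal{G}_{\mathrm{aux}},\Phi)$ be an extended convex lifting (ECL) of $f$. If a non-degenerate point $x^\ast\in\mathcal{D}_{\mathrm{nd}}$ is a Clarke stationary point, i.e., $0\in\partial f(x^\ast)$, then $x^\ast$ is a global minimizer of $f(x)$ over $\mathcal{D}$.
   Context: For $f:\mathcal{D}\to\mathbb{R}$ with $\mathcal{D}\subseteq\mathbb{R}^d$, put $\operatorname{epi}_>(f)=\{(x,\gamma)\in\mathcal{D}\times\mathbb{R}\mid \gamma>f(x)\}$ and $\operatorname{epi}_\geq(f)=\{(x,\gamma)\in\mathcal{D}\times\mathbb{R}\mid \gamma\geq f(x)\}$; $\operatorname{cl}$ denotes closure in $\mathbb{R}^{d}\times\mathbb{R}$. Definition (ECL). Let $f:\mathcal{D}\to\mathbb{R}$ be continuous, $\mathcal{D}\subseteq\mathbb{R}^d$. The tuple $(\mathcal{L}_{\mathrm{lft}},\mathcal{F}_{\mathrm{cvx}},\mathcal{G}_{\mathrm{aux}},\Phi)$ is an extended convex lifting (ECL) of $f$ if: (1) $\mathcal{L}_{\mathrm{lft}}\subseteq\mathbb{R}^d\times\mathbb{R}\times\mathbb{R}^{d_\xi}$ is a set whose canonical projection $\pi_{x,\gamma}(\mathcal{L}_{\mathrm{lft}})=\{(x,\gamma): \exists\,\xi\in\mathbb{R}^{d_\xi}\text{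 s.t. }(x,\gamma,\xi)\in\mathcal{L}_{\mathrm{lft}}\}$ satisfies $\operatorname{epi}_>(f)\subseteq\pi_{x,\gamma}(\mathcal{L}_{\mathrm{lft}})\subseteq\operatorname{cl}\operatorname{epi}_\geq(f)$; (2) $\mathcal{F}_{\mathrm{cvx}}\subseteq\mathbb{R}\times\mathbb{R}^{d_1}$ is a convex set, $\mathcal{G}_{\mathrm{aux}}\subseteq\mathbb{R}^{d_2}$ is a set (the auxiliary set), and $\Phi$ is a $C^2$ diffeomorphism from $\mathcal{L}_{\mathrm{lft}}$ to $\mathcal{F}_{\mathrm{cvx}}\times\mathcal{G}_{\mathrm{aux}}$, meaning that $\Phi$ is a bijection from $\mathcal{L}_{\mathrm{lft}}$ onto $\mathcal{F}_{\mathrm{cvx}}\times\mathcal{G}_{\mathrm{aux}}$ that extends to a $C^2$ function $\tilde\Phi$ on some open set $U\supseteq\mathcal{L}_{\mathrm{lft}}$ of $\mathbb{R}^d\times\mathbb{R}\times\mathbb{R}^{d_\xi}$ such that $\tilde\Phi$ is a bijection from $U$ to $\tilde\Phi(U)$ with $C^2$ inverse. ($d_2=0$ is allowed, with $\mathcal{G}_{\mathrm{aux}}=\mathbb{R}^0=\{0\}$ and $\mathcal{F}_{\mathrm{cvx}}\times\{0\}$ identified with $\mathcal{F}_{\mathrm{cvx}}$; $\mathcal{G}_{\mathrm{aux}}$ may be nonconvex or disconnected.) (3) For every $(x,\gamma,\xi)\in\mathcal{L}_{\mathrm{lft}}$, $\Phi(x,\gamma,\xi)=(\gamma,\zeta_1,\zeta_2)$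 with $(\gamma,\zeta_1)\in\mathcal{F}_{\mathrm{cvx}}$, for some $\zeta_1\in\mathbb{R}^{d_1}$ and $\zeta_2\in\mathcal{G}_{\mathrm{aux}}$ (i.e. $\Phi$ outputs $\gamma$ itself as its first component). Non-degenerate points. Given an ECL of $f$, a point $x\in\mathcal{D}$ is non-degenerate if $(x,f(x))\in\pi_{x,\gamma}(\mathcal{L}_{\mathrm{lft}})$; $\mathcal{D}_{\mathrm{nd}}$ is the set of non-degenerate points. Clarke notions. For locally Lipschitz $f$ on an open set, $f^\circ(x;v)=\limsup_{x'\to x,\,t\downarrow0}\frac{f(x'+tv)-f(x')}{t}$ and $\partial f(x)=\{g: f^\circ(x;v)\ge\langle g,v\rangle\ \forall v\in\mathbb{R}^d\}$. The function $f$ is subdifferentially regular if it is locally Lipschitz and, for every $x\in\mathcal{D}$ and every $v$, the directional derivative $\lim_{t\downarrow0}\frac{f(x+tv)-f(x)}{t}$ exists and equals $f^\circ(x;v)$. *)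

theory Defs
  imports "HOL-Analysis.Analysis"
begin

text \<open>
  Real inner product spaces of finite dimension, dimension 0 included. The class
  \<^class>\<open>euclidean_space\<close> excludes dimension 0, whereas the auxiliary set of a lifting may live
  in the zero-dimensional space (as may the lifting variable and the remaining convex
  coordinates). The instances below show that the class contains every Euclidean space and
  the zero-dimensional space \<^typ>\<open>unit\<close>.
\<close>

class finite_dim_inner = real_inner +
  assumes finite_dim: "\<exists>B. finite B \<and> (\<forall>x. \<exists>c. x = (\<Sum>b\<in>B. c b *\<^sub>R b))"

instance euclidean_space \<subseteq> finite_dim_inner
proof
  show "\<exists>B::'a set. finite B \<and> (\<forall>x. \<exists>c. x = (\<Sum>b\<in>B. c b *\<^sub>R b))"
    by (metis euclidean_representation finite_Basis)
qed

instantiation unit :: real_inner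
begin

definition zero_unit :: unit where "zero_unit = ()"
definition plus_unit :: "unit \<Rightarrow> unit \<Rightarrow> unit" where "plus_unit x y = ()"
definition scaleR_unit :: "real \<Rightarrow> unit \<Rightarrow> unit" where "scaleR_unit r x = ()"
definition inner_unit :: "unit \<Rightarrow> unit \<Rightarrow> real" where "inner_unit x y = 0"
definition norm_unit :: "unit \<Rightarrow> real" where "norm_unit x = 0"
definition dist_unit :: "unit \<Rightarrow> unit \<Rightarrow> real" where "dist_unit x y = 0"
definition sgn_unit :: "unit \<Rightarrow> unit" where "sgn_unit x = ()"
definition uniformity_unit :: "(unit \<times> unit) filter" where
  "uniformity_unit = (INF e\<in>{0<..}. principal {(x, y). dist x y < e})"
definition open_unit :: "unit set \<Rightarrow> bool" where
  "open_unit U = (\<forall>x\<in>U. \<forall>\<^sub>F (x', y) in uniformity. x' = x \<longrightarrow> y \<in> U)"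

instance
  by standard
    (auto simp: inner_unit_def norm_unit_def dist_unit_def uniformity_unit_def open_unit_def)

end

instance unit :: finite_dim_inner
proof
  show "\<exists>B::unit set. finite B \<and> (\<forall>x. \<exists>c. x = (\<Sum>b\<in>B. c b *\<^sub>R b))"
    by (intro exI[of _ UNIV]) simp
qed


definition strict_epigraph :: "'a set \<Rightarrow> ('a \<Rightarrow> real) \<Rightarrow> ('a \<times> real) set" where
  "strict_epigraph D f = {(x, \<gamma>). x \<in> D \<and> f x < \<gamma>}"


definition C2_on :: "'a::real_normed_vector set \<Rightarrow> ('a \<Rightarrow> 'b::real_normed_vector) \<Rightarrow> bool" where
  "C2_on U f \<longleftrightarrow> open U \<and>
    (\<exists>(f' :: 'a \<Rightarrow> 'a \<Rightarrow>\<^sub>L 'b) (f'' :: 'a \<Rightarrow> 'a \<Rightarrow>\<^sub>L ('a \<Rightarrow>\<^sub>L 'b)).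
      (\<forall>x\<in>U. (f has_derivative blinfun_apply (f' x)) (at x)) \<and>
      (\<forall>x\<in>U. (f' has_derivative blinfun_apply (f'' x)) (at x)) \<and>
      continuous_on U f'')"

text \<open>
  On a set that need not be open, \<open>C\<^sup>2\<close> means, as usual, being the restriction of a \<open>C\<^sup>2\<close> function
  defined on an open superset; on an open set this agrees with \<^const>\<open>C2_on\<close>.
\<close>

definition C2_extendable_on :: "'a::real_normed_vector set \<Rightarrow> ('a \<Rightarrow> 'b::real_normed_vector) \<Rightarrow> bool" where
  "C2_extendable_on S f \<longleftrightarrow> (\<exists>V g. S \<subseteq> V \<and> C2_on V g \<and> (\<forall>x\<in>S. g x = f x))"

text \<open>
  The inverse of the extension lives on the image of \<open>U\<close>. Domain and codomain are not required
  to have equal dimension, so that image need not be open.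
\<close>

definition C2_diffeomorphism ::
    "'a::real_normed_vector set \<Rightarrow> 'b::real_normed_vector set \<Rightarrow> ('a \<Rightarrow> 'b) \<Rightarrow> bool" where
  "C2_diffeomorphism A B \<Phi> \<longleftrightarrow> bij_betw \<Phi> A B \<and>
    (\<exists>U \<Psi>. open U \<and> A \<subseteq> U \<and> (\<forall>p\<in>A. \<Psi> p = \<Phi> p) \<and> C2_on U \<Psi> \<and>
      bij_betw \<Psi> U (\<Psi> ` U) \<and> C2_extendable_on (\<Psi> ` U) (inv_into U \<Psi>))"


definition proj_x\<gamma> :: "('x \<times> real \<times> 'xi) set \<Rightarrow> ('x \<times> real) set" where
  "proj_x\<gamma> L = {(x, \<gamma>). \<exists>\<xi>. (x, \<gamma>, \<xi>) \<in> L}"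

text \<open>
  Functions on \<open>D\<close> and on \<open>L\<close> are total functions whose values outside these sets play no role.
  Triples associate to the right, so the set comprehension below is the product of \<open>F\<close> and \<open>G\<close>
  up to reassociation; if \<open>'z2\<close> has dimension 0, it is \<open>F \<times> {0}\<close>.
\<close>

definition extended_convex_lifting ::
    "'x::finite_dim_inner set \<Rightarrow> ('x \<Rightarrow> real) \<Rightarrow>
     ('x \<times> real \<times> 'xi::finite_dim_inner) set \<Rightarrow>
     (real \<times> 'z1::finite_dim_inner) set \<Rightarrow> 'z2::finite_dim_inner set \<Rightarrow>
     ('x \<times> real \<times> 'xi \<Rightarrow> real \<times> 'z1 \<times> 'z2) \<Rightarrow> bool" where
  "extended_convex_lifting D f L F G \<Phi> \<longleftrightarrow>
     continuous_on D f \<and>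
     strict_epigraph D f \<subseteq> proj_x\<gamma> L \<and> proj_x\<gamma> L \<subseteq> closure (epigraph D f) \<and>
     convex F \<and>
     C2_diffeomorphism L {(\<gamma>, \<zeta>1, \<zeta>2). (\<gamma>, \<zeta>1) \<in> F \<and> \<zeta>2 \<in> G} \<Phi> \<and>
     (\<forall>x \<gamma> \<xi>. (x, \<gamma>, \<xi>) \<in> L \<longrightarrow>
        (\<exists>\<zeta>1 \<zeta>2. \<Phi> (x, \<gamma>, \<xi>) = (\<gamma>, \<zeta>1, \<zeta>2) \<and> (\<gamma>, \<zeta>1) \<in> F \<and> \<zeta>2 \<in> G))"

definition nondegenerate_points ::
    "'x set \<Rightarrow> ('x \<Rightarrow> real) \<Rightarrow> ('x \<times> real \<times> 'xi) set \<Rightarrow> 'x set" where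
  "nondegenerate_points D f L = {x \<in> D. (x, f x) \<in> proj_x\<gamma> L}"


definition locally_Lipschitz_on :: "'a::metric_space set \<Rightarrow> ('a \<Rightarrow> real) \<Rightarrow> bool" where
  "locally_Lipschitz_on D f \<longleftrightarrow> (\<forall>x\<in>D. \<exists>r>0. \<exists>C. C-lipschitz_on (ball x r \<inter> D) f)"

text \<open>
  The base point \<open>x'\<close> ranges over full neighbourhoods of \<open>x\<close>, with \<open>x' = x\<close> allowed. For \<open>x\<close> in an
  open \<open>D\<close>, both \<open>x'\<close> and \<open>x' + t v\<close> eventually lie in \<open>D\<close>, so only values of \<open>f\<close> on \<open>D\<close> matter.
\<close>

definition clarke_dd :: "('a::real_normed_vector \<Rightarrow> real) \<Rightarrow> 'a \<Rightarrow> 'a \<Rightarrow> ereal" where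
  "clarke_dd f x v =
     Limsup (nhds x \<times>\<^sub>F at_right 0) (\<lambda>(x', t). ereal ((f (x' + t *\<^sub>R v) - f x') / t))"

definition clarke_subdifferential :: "('a::real_inner \<Rightarrow> real) \<Rightarrow> 'a \<Rightarrow> 'a set" where
  "clarke_subdifferential f x = {g. \<forall>v. ereal (g \<bullet> v) \<le> clarke_dd f x v}"

definition subdifferentially_regular :: "'a::real_normed_vector set \<Rightarrow> ('a \<Rightarrow> real) \<Rightarrow> bool" where
  "subdifferentially_regular D f \<longleftrightarrow> locally_Lipschitz_on D f \<and>
     (\<forall>x\<in>D. \<forall>v. \<exists>l. ((\<lambda>t. (f (x + t *\<^sub>R v) - f x) / t) \<longlongrightarrow> l) (at_right 0) \<and>
        ereal l = clarke_dd f x v)"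

end

theory Submission
  imports Defs
begin

text \<open>
  If \<open>f x0 < f xs\<close>, choose \<open>\<gamma>0\<close> strictly between these two values. The points \<open>(xs, f xs)\<close> and
  \<open>(x0, \<gamma>0)\<close> both lie in the projection of the lifted set, the first by non-degeneracy and
  the second because it is in the strict epigraph. In the coordinates given by \<open>\<Phi>\<close> join their
  images by a segment in the convex set \<open>F\<close>, keeping the \<open>G\<close>-coordinate fixed, and pull the segment
  back by the inverse of \<open>\<Phi>\<close>. Since \<open>\<Phi>\<close> preserves \<open>\<gamma>\<close>, this gives a curve \<open>c\<close> with
  \<open>c 0 = xs\<close>, differentiable at \<open>0\<close>, along which \<open>(c t, (1 - t) f xs + t \<gamma>0)\<close> stays in the
  projection of the lifted set (lemma \<open>lifting_curve\<close>), hence in the closure of the epigraph.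
  As \<open>f\<close> is continuous on the open set \<open>D\<close>, this means \<open>f (c t) \<le> f xs - t (f xs - \<gamma>0)\<close>
  for small \<open>t\<close> (lemma \<open>closure_epigraph_imp_le\<close>).

  A locally Lipschitz function has the same one-sided derivative along \<open>c\<close> as along the tangent
  line of \<open>c\<close> (lemma \<open>directional_derivative_along_curve\<close>), so the directional derivative of \<open>f\<close>
  at \<open>xs\<close> in the direction \<open>c' 0\<close> is at most \<open>\<gamma>0 - f xs < 0\<close>. By regularity it equals the Clarke
  directional derivative, which Clarke stationarity makes nonnegative: a contradiction.
\<close>

lemma closure_epigraph_imp_le:
  fixes f :: "'a::metric_space \<Rightarrow> real"
  assumes "open D" and "continuous_on D f"
    and "(x, \<gamma>) \<in> closure (epigraph D f)" and "x \<in> D"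
  shows "f x \<le> \<gamma>"
proof -
  obtain s where s: "\<And>n. s n \<in> epigraph D f" and lim: "s \<longlonglongrightarrow> (x, \<gamma>)"
    using assms(3) unfolding closure_sequential by blast
  have "isCont f x"
    using assms continuous_on_eq_continuous_at by blast
  then have "(\<lambda>n. f (fst (s n))) \<longlonglongrightarrow> f x"
    using isCont_tendsto_compose tendsto_fst[OF lim] by fastforce
  moreover have "(\<lambda>n. snd (s n)) \<longlonglongrightarrow> \<gamma>"
    using tendsto_snd[OF lim] by simp
  moreover have "f (fst (s n)) \<le> snd (s n)" for n
    using s[of n] by (simp add: epigraph_def)
  ultimately show ?thesis
    by (blast intro: LIMSEQ_le)
qed

lemma directional_derivative_along_curve:
  fixes f :: "'a::real_normed_vector \<Rightarrow> real" and c :: "real \<Rightarrow> 'a"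
  assumes "open D" and "locally_Lipschitz_on D f" and "c 0 \<in> D"
    and c: "(c has_vector_derivative v) (at 0)"
    and l: "((\<lambda>t. (f (c 0 + t *\<^sub>R v) - f (c 0)) / t) \<longlongrightarrow> l) (at_right 0)"
  shows "((\<lambda>t. (f (c t) - f (c 0)) / t) \<longlongrightarrow> l) (at_right 0)"
proof -
  obtain r C where "r > 0" and lip: "C-lipschitz_on (ball (c 0) r \<inter> D) f"
    using assms unfolding locally_Lipschitz_on_def by blast
  define N where "N = ball (c 0) r \<inter> D"
  have N: "open N" "c 0 \<in> N"
    using assms \<open>r > 0\<close> by (auto simp: N_def)
  have "isCont c 0"
    using c has_vector_derivative_continuous by blast
  then have "(c \<longlongrightarrow> c 0) (at_right 0)"
    by (simp add: isCont_def filterlim_at_split)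
  then have c_in: "\<forall>\<^sub>F t in at_right 0. c t \<in> N"
    using N topological_tendstoD by blast
  have "((\<lambda>t. c 0 + t *\<^sub>R v) \<longlongrightarrow> c 0 + 0 *\<^sub>R v) (at_right 0)"
    by (intro tendsto_intros)
  then have line_in: "\<forall>\<^sub>F t in at_right 0. c 0 + t *\<^sub>R v \<in> N"
    using N topological_tendstoD[of _ "c 0"] by simp
  have "((\<lambda>t. norm (c t - c 0 - t *\<^sub>R v) / \<bar>t\<bar>) \<longlongrightarrow> 0) (at 0)"
    using c unfolding has_vector_derivative_def has_derivative_at by simp
  then have small: "((\<lambda>t. C * (norm (c t - c 0 - t *\<^sub>R v) / \<bar>t\<bar>)) \<longlongrightarrow> 0) (at_right 0)"
    using tendsto_mult_right_zero filterlim_at_split by blast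
  have "\<forall>\<^sub>F t in at_right 0.
      norm ((f (c t) - f (c 0 + t *\<^sub>R v)) / t) \<le> C * (norm (c t - c 0 - t *\<^sub>R v) / \<bar>t\<bar>)"
    using c_in line_in
  proof eventually_elim
    case (elim t)
    have "\<bar>f (c t) - f (c 0 + t *\<^sub>R v)\<bar> \<le> C * norm (c t - c 0 - t *\<^sub>R v)"
      using lipschitz_onD[OF lip, of "c t" "c 0 + t *\<^sub>R v"] elim
      by (simp add: N_def dist_norm algebra_simps)
    then show ?case
      by (simp add: abs_divide divide_right_mono)
  qed
  then have "((\<lambda>t. (f (c t) - f (c 0 + t *\<^sub>R v)) / t) \<longlongrightarrow> 0) (at_right 0)"
    using small by (rule Lim_null_comparison)
  from tendsto_add[OF this l] show ?thesis
    by (simp add: diff_divide_distrib)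
qed

text \<open>
  The curve is the \<open>x\<close>-component of the pull-back of a segment in \<open>F \<times> {\<zeta>2}\<close>, where \<open>\<zeta>2\<close> is the
  \<open>G\<close>-coordinate of the image under \<open>\<Phi>\<close> of a lift of \<open>(x, \<gamma>)\<close>. The extended inverse of \<open>\<Phi>\<close> only
  needs to be differentiable at that image, the starting point of the segment. The curve is
  defined for all real \<open>t\<close>; outside \<open>{0..1}\<close> its values carry no
  information about \<open>L\<close>.
\<close>

lemma lifting_curve:
  assumes ecl: "extended_convex_lifting D f L F G \<Phi>"
    and "(x, \<gamma>) \<in> proj_x\<gamma> L" and "(x0, \<gamma>0) \<in> proj_x\<gamma> L"
  obtains c v where "c 0 = x" and "(c has_vector_derivative v) (at 0)"
    and "\<And>t. 0 \<le> t \<Longrightarrow> t \<le> 1 \<Longrightarrow> (c t, (1 - t) * \<gamma> + t * \<gamma>0) \<in> proj_x\<gamma> L"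
proof -
  let ?B = "{(\<gamma>, \<zeta>1, \<zeta>2). (\<gamma>, \<zeta>1) \<in> F \<and> \<zeta>2 \<in> G}"
  have "convex F" and diffeo: "C2_diffeomorphism L ?B \<Phi>"
    and \<Phi>: "\<And>x \<gamma> \<xi>. (x, \<gamma>, \<xi>) \<in> L \<Longrightarrow>
      \<exists>\<zeta>1 \<zeta>2. \<Phi> (x, \<gamma>, \<xi>) = (\<gamma>, \<zeta>1, \<zeta>2) \<and> (\<gamma>, \<zeta>1) \<in> F \<and> \<zeta>2 \<in> G"
    using ecl unfolding extended_convex_lifting_def by auto
  obtain U \<Psi> V g where onto: "\<Phi> ` L = ?B"
    and "L \<subseteq> U" and \<Psi>: "\<And>p. p \<in> L \<Longrightarrow> \<Psi> p = \<Phi> p" and inj: "inj_on \<Psi> U"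
    and V: "\<Psi> ` U \<subseteq> V" and "C2_on V g" and g: "\<And>y. y \<in> \<Psi> ` U \<Longrightarrow> g y = inv_into U \<Psi> y"
    using diffeo unfolding C2_diffeomorphism_def C2_extendable_on_def bij_betw_def by metis
  have g_\<Phi>: "g (\<Phi> p) = p" and \<Phi>_V: "\<Phi> p \<in> V" if "p \<in> L" for p
  proof -
    have "p \<in> U" "\<Phi> p = \<Psi> p"
      using that \<open>L \<subseteq> U\<close> \<Psi> by auto
    then show "g (\<Phi> p) = p" "\<Phi> p \<in> V"
      using g[of "\<Psi> p"] inj V by auto
  qed
  obtain \<xi> \<xi>0 where L: "(x, \<gamma>, \<xi>) \<in> L" and L0: "(x0, \<gamma>0, \<xi>0) \<in> L"
    using assms by (auto simp: proj_x\<gamma>_def)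
  obtain \<zeta>1 \<zeta>2 where z: "\<Phi> (x, \<gamma>, \<xi>) = (\<gamma>, \<zeta>1, \<zeta>2)" "(\<gamma>, \<zeta>1) \<in> F" "\<zeta>2 \<in> G"
    using \<Phi>[OF L] by blast
  obtain \<eta>1 where e: "(\<gamma>0, \<eta>1) \<in> F"
    using \<Phi>[OF L0] by blast
  define q where "q t = (\<gamma>, \<zeta>1, \<zeta>2) + t *\<^sub>R (\<gamma>0 - \<gamma>, \<eta>1 - \<zeta>1, 0)" for t :: real
  define c where "c t = fst (g (q t))" for t
  have q0: "q 0 = \<Phi> (x, \<gamma>, \<xi>)"
    by (simp add: q_def z zero_prod_def[symmetric])
  have "q 0 \<in> V"
    using \<Phi>_V[OF L] q0 by simp
  then obtain g' where g': "(g has_derivative blinfun_apply g') (at (q 0))"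
    using \<open>C2_on V g\<close> unfolding C2_on_def by blast
  have q': "(q has_vector_derivative (\<gamma>0 - \<gamma>, \<eta>1 - \<zeta>1, 0)) (at 0)"
    unfolding q_def by (auto intro!: derivative_eq_intros)
  have "((\<lambda>t. g (q t)) has_vector_derivative blinfun_apply g' (\<gamma>0 - \<gamma>, \<eta>1 - \<zeta>1, 0)) (at 0)"
    using vector_derivative_diff_chain_within[OF q' has_derivative_at_withinI[OF g']]
    by (simp add: o_def)
  then have "(c has_vector_derivative fst (blinfun_apply g' (\<gamma>0 - \<gamma>, \<eta>1 - \<zeta>1, 0))) (at 0)"
    unfolding c_def by (rule bounded_linear.has_vector_derivative[OF bounded_linear_fst])
  moreover have "c 0 = x"
    using g_\<Phi>[OF L] q0 by (simp add: c_def)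
  moreover have "(c t, (1 - t) * \<gamma> + t * \<gamma>0) \<in> proj_x\<gamma> L" if t: "0 \<le> t" "t \<le> 1" for t
  proof -
    have qt: "q t = ((1 - t) * \<gamma> + t * \<gamma>0, (1 - t) *\<^sub>R \<zeta>1 + t *\<^sub>R \<eta>1, \<zeta>2)"
      by (simp add: q_def algebra_simps)
    have "(1 - t) *\<^sub>R (\<gamma>, \<zeta>1) + t *\<^sub>R (\<gamma>0, \<eta>1) \<in> F"
      using convexD[OF \<open>convex F\<close> z(2) e, of "1 - t" t] t by simp
    then have "q t \<in> ?B"
      using z by (simp add: qt)
    then obtain y \<beta> \<eta> where p: "(y, \<beta>, \<eta>) \<in> L" "\<Phi> (y, \<beta>, \<eta>) = q t"
      using onto by (metis (no_types, lifting) imageE prod_cases3)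
    have "\<beta> = (1 - t) * \<gamma> + t * \<gamma>0"
      using \<Phi>[OF p(1)] p(2) qt by auto
    moreover have "c t = y"
      using g_\<Phi>[OF p(1)] p(2) by (simp add: c_def)
    ultimately show ?thesis
      using p by (auto simp: proj_x\<gamma>_def)
  qed
  ultimately show ?thesis
    using that by blast
qed

theorem theorem3p2:
  fixes D :: "'x::finite_dim_inner set"
    and f :: "'x \<Rightarrow> real"
    and L :: "('x \<times> real \<times> 'xi::finite_dim_inner) set"
    and F :: "(real \<times> 'z1::finite_dim_inner) set"
    and G :: "'z2::finite_dim_inner set"
    and \<Phi> :: "'x \<times> real \<times> 'xi \<Rightarrow> real \<times> 'z1 \<times> 'z2"
    and xs :: 'x
  assumes "open D"
    and "subdifferentially_regular D f"
    and "extended_convex_lifting D f L F G \<Phi>"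
    and "xs \<in> nondegenerate_points D f L"
    and "0 \<in> clarke_subdifferential f xs"
  shows "\<forall>x\<in>D. f xs \<le> f x"
proof (rule ccontr)
  assume "\<not> ?thesis"
  then obtain x0 where x0: "x0 \<in> D" "f x0 < f xs"
    by auto
  then obtain \<gamma>0 where \<gamma>0: "f x0 < \<gamma>0" "\<gamma>0 < f xs"
    using dense by blast
  have cont: "continuous_on D f"
    and lower: "strict_epigraph D f \<subseteq> proj_x\<gamma> L"
    and upper: "proj_x\<gamma> L \<subseteq> closure (epigraph D f)"
    using assms(3) unfolding extended_convex_lifting_def by auto
  have xs: "xs \<in> D" "(xs, f xs) \<in> proj_x\<gamma> L"
    using assms(4) by (auto simp: nondegenerate_points_def)
  have "(x0, \<gamma>0) \<in> proj_x\<gamma> L"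
    using lower x0 \<gamma>0 by (auto simp: strict_epigraph_def)
  then obtain c v where c0: "c 0 = xs" and c: "(c has_vector_derivative v) (at 0)"
    and cL: "\<And>t. 0 \<le> t \<Longrightarrow> t \<le> 1 \<Longrightarrow> (c t, (1 - t) * f xs + t * \<gamma>0) \<in> proj_x\<gamma> L"
    using lifting_curve[OF assms(3) xs(2)] by metis
  obtain l where l: "((\<lambda>t. (f (xs + t *\<^sub>R v) - f xs) / t) \<longlongrightarrow> l) (at_right 0)"
    and clarke: "ereal l = clarke_dd f xs v"
    using assms(2) xs unfolding subdifferentially_regular_def by blast
  have "ereal (0 \<bullet> v) \<le> clarke_dd f xs v"
    using assms(5) unfolding clarke_subdifferential_def by blast
  then have "0 \<le> l"
    unfolding clarke[symmetric] by simp
  have "((\<lambda>t. (f (c t) - f xs) / t) \<longlongrightarrow> l) (at_right 0)"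
    using directional_derivative_along_curve[of D f c v l] assms(1,2) xs c l
    by (simp add: c0 subdifferentially_regular_def)
  moreover have "\<forall>\<^sub>F t in at_right 0. (f (c t) - f xs) / t \<le> \<gamma>0 - f xs"
  proof -
    have "isCont c 0"
      using c has_vector_derivative_continuous by blast
    then have "(c \<longlongrightarrow> xs) (at_right 0)"
      by (simp add: isCont_def filterlim_at_split c0)
    then have "\<forall>\<^sub>F t in at_right 0. c t \<in> D"
      using assms(1) xs topological_tendstoD by blast
    moreover have "\<forall>\<^sub>F t in at_right 0. t \<in> {0<..<1::real}"
      by (rule eventually_at_right_real) simp
    ultimately show ?thesis
    proof eventually_elim
      case (elim t)
      then have "(c t, (1 - t) * f xs + t * \<gamma>0) \<in> closure (epigraph D f)"
        using cL[of t] upper by auto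
      then have "f (c t) \<le> (1 - t) * f xs + t * \<gamma>0"
        using closure_epigraph_imp_le assms(1) cont elim by blast
      then show ?case
        using elim by (simp add: divide_simps algebra_simps)
    qed
  qed
  ultimately have "l \<le> \<gamma>0 - f xs"
    by (rule tendsto_upperbound) simp
  then show False
    using \<open>0 \<le> l\<close> \<gamma>0 by simp
qed

end
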